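(* Let $Q$ be a finite-dimensional real vector space, $\Delta t,\Delta x>0$, and let $H_d^+:Q\times Q\times Q^*\times Q^*\to\mathbb{R}$ be a (smooth) discrete boundary Hamiltonian. The discrete forward Hamilton's equations on $\Box_{ab}$, $$\pi^1_{[a]b}=\tfrac{1}{\Delta t}D_1H_d^+,\qquad \pi^0_{a[b]}=\tfrac{1}{\Delta x}D_2H_d^+,\qquad \varphi_{[a]b+1}=\tfrac{1}{\Delta t}D_3H_d^+,\qquad \varphi_{a+1[b]}=\tfrac{1}{\Delta x}D_4H_d^+,$$ with $H_d^+$ and its partial derivatives $D_iH_d^+$ (with respect to the $i$-th argument) evaluated at $(\varphi_{[a]b},\varphi_{a[b]},\pi^1_{[a]b+1},\pi^0_{a+1[b]})$, are multisymplectic, in the sense that for a solution of the discrete forward Hamilton's equations, $$\Delta t\, d\varphi_{[a]b+1}\wedge d\pi^1_{[a]b+1}-\Delta t\, d\varphi_{[a]b}\wedge d\pi^1_{[a]b}+\Delta x\, d\varphi_{a+1[b]}\wedge d\pi^0_{a+1[b]}-\Delta x\, d\varphi_{a[b]}\wedge d\pi^0_{a[b]}=0$$ when evaluated on any pair of discrete first variations.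
   Context: Setting: $\Box_{ab}=[t_a,t_a+\Delta t]\times[x_b,x_b+\Delta x]$ is an element of a rectangular mesh in $1+1$ dimensions, with one quadrature point on each edge. $\varphi_{[a]b},\varphi_{[a]b+1}\in Q$ are the field values at the quadrature points of the edges $x=x_b$ and $x=x_b+\Delta x$, and $\pi^1_{[a]b},\pi^1_{[a]b+1}\in Q^*$ the corresponding normal momenta ($x$ direction); $\varphi_{a[b]},\varphi_{a+1[b]}\in Q$ are the field values at the quadrature points of the edges $t=t_a$ and $t=t_a+\Delta t$, and $\pi^0_{a[b]},\pi^0_{a+1[b]}\in Q^*$ the corresponding normal momenta ($t$ direction). The discrete boundary Hamiltonian $H_d^+$ is $$H_d^+(\varphi_{[a]b},\varphi_{a[b]},\pi^1_{[a]b+1},\pi^0_{a+1[b]})=\operatorname{ext}\Big(\pi^1_{[a]b+1}\varphi_{[a]b+1}\Delta t+\pi^0_{a+1[b]}\varphi_{a+1[b]}\Delta x-S_d^{\Box_{ab}}[\phi,p]\Big),$$ the extremal value over discrete fields and momenta on $\Box_{ab}$ with the prescribed boundary values, where $S_d^{\Box_{ab}}$ is some discrete approximation of the action; here only its being a smooth function of its arguments matters. The wedge product includes the (suppressed) duality pairing: in linear coordinates $\varphi^A$ on $Q$ and dual coordinates $\pi_A$ on $Q^*$, $d\varphi\wedge d\pi=\sum_A d\varphi^A\wedge d\pi_A$. A discrete first variation at a solution is a vector $V$ tangent to the space of all eight boundary values $(\varphi_{[a]b},\varphi_{a[b]},\varphi_{[a]b+1},\varphi_{a+1[b]},\pi^1_{[a]b},\pi^0_{a[b]},\pi^1_{[a]b+1},\pi^0_{a+1[b]})$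 for which the discrete forward Hamilton's equations hold at the level of the exterior derivative, i.e. $d\pi^1_{[a]b}(V)=\frac{1}{\Delta t}d(D_1H_d^+)(V)$, $d\pi^0_{a[b]}(V)=\frac{1}{\Delta x}d(D_2H_d^+)(V)$, $d\varphi_{[a]b+1}(V)=\frac{1}{\Delta t}d(D_3H_d^+)(V)$, $d\varphi_{a+1[b]}(V)=\frac{1}{\Delta x}d(D_4H_d^+)(V)$. *)

theory Defs
  imports "HOL-Analysis.Analysis"
begin

text \<open>
  The space $Q$ is a type of class \<^class>\<open>real_normed_vector\<close> whose finite dimension is assumed in
  the theorem. The norm only provides the topology needed for differentiation; on a
  finite-dimensional space all norms are equivalent and every linear functional is bounded, so
  the bounded functionals below form the full dual $Q^*$.
\<close>

type_synonym 'q dual = "'q \<Rightarrow>\<^sub>L real"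

type_synonym 'q ham_args = "'q \<times> 'q \<times> 'q dual \<times> 'q dual"

text \<open>
  Class $C^k$, through iterated derivatives in fixed directions. On finite-dimensional spaces this
  is the usual notion; fixing the directions keeps the codomain type constant in the recursion.
\<close>

primrec C_k :: "nat \<Rightarrow> ('a::real_normed_vector \<Rightarrow> 'b::real_normed_vector) \<Rightarrow> bool" where
  "C_k 0 f \<longleftrightarrow> continuous_on UNIV f"
| "C_k (Suc k) f \<longleftrightarrow>
     (\<forall>x. f differentiable (at x)) \<and> (\<forall>v. C_k k (\<lambda>x. frechet_derivative f (at x) v))"

definition smooth :: "('a::real_normed_vector \<Rightarrow> 'b::real_normed_vector) \<Rightarrow> bool" where
  "smooth f \<longleftrightarrow> (\<forall>k. C_k k f)"

text \<open>
  The exterior derivative at \<open>z\<close> of a vector-valued function, as a linear map on tangent vectors.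
  Tangent spaces of a vector space are identified with the space itself.
\<close>

definition ext_deriv ::
    "('a::real_normed_vector \<Rightarrow> 'b::real_normed_vector) \<Rightarrow> 'a \<Rightarrow> 'a \<Rightarrow> 'b" where
  "ext_deriv f z = frechet_derivative f (at z)"

text \<open>Wedge product of a $Q$-valued and a $Q^*$-valued one-form, including the duality pairing.\<close>

definition wedge ::
    "('v \<Rightarrow> 'q::real_normed_vector) \<Rightarrow> ('v \<Rightarrow> 'q dual) \<Rightarrow> 'v \<Rightarrow> 'v \<Rightarrow> real" where
  "wedge \<alpha> \<beta> V W = blinfun_apply (\<beta> W) (\<alpha> V) - blinfun_apply (\<beta> V) (\<alpha> W)"

text \<open>
  In linear coordinates \<open>\<xi> A\<close> on $Q$ with respect to vectors \<open>e A\<close>, and the dual coordinates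
  $\pi_A = \pi(e_A)$ on $Q^*$, this is the sum of the scalar wedge products.
\<close>

lemma wedge_coordinates:
  fixes e :: "'i \<Rightarrow> 'q::real_normed_vector" and \<xi> :: "'i \<Rightarrow> 'q \<Rightarrow> real"
  assumes "\<And>x. x = (\<Sum>A\<in>I. \<xi> A x *\<^sub>R e A)"
  shows "wedge \<alpha> \<beta> V W =
    (\<Sum>A\<in>I. \<xi> A (\<alpha> V) * blinfun_apply (\<beta> W) (e A) - \<xi> A (\<alpha> W) * blinfun_apply (\<beta> V) (e A))"
proof -
  have pairing: "blinfun_apply p x = (\<Sum>A\<in>I. \<xi> A x * blinfun_apply p (e A))" for p :: "'q dual" and x
    by (subst assms[of x]) (simp add: blinfun.sum_right blinfun.scaleR_right)
  show ?thesis
    by (simp add: wedge_def pairing[of _ "\<alpha> V"] pairing[of _ "\<alpha> W"] sum_subtractf)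
qed

text \<open>
  The canonical map $Q \to Q^{**}$, an isomorphism in finite dimension. It expresses the
  identification under which $D_3 H$ and $D_4 H$, derivatives in $Q^*$ directions, lie in $Q$.
\<close>

definition bidual :: "'q::real_normed_vector \<Rightarrow> 'q dual dual" where
  "bidual x = Blinfun (\<lambda>p. blinfun_apply p x)"

definition D1 :: "('q::real_normed_vector ham_args \<Rightarrow> real) \<Rightarrow> 'q ham_args \<Rightarrow> 'q dual" where
  "D1 H = (\<lambda>(x, t, px, pt). Blinfun (frechet_derivative (\<lambda>u. H (u, t, px, pt)) (at x)))"

definition D2 :: "('q::real_normed_vector ham_args \<Rightarrow> real) \<Rightarrow> 'q ham_args \<Rightarrow> 'q dual" where
  "D2 H = (\<lambda>(x, t, px, pt). Blinfun (frechet_derivative (\<lambda>u. H (x, u, px, pt)) (at t)))"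

definition D3 :: "('q::real_normed_vector ham_args \<Rightarrow> real) \<Rightarrow> 'q ham_args \<Rightarrow> 'q dual dual" where
  "D3 H = (\<lambda>(x, t, px, pt). Blinfun (frechet_derivative (\<lambda>u. H (x, t, u, pt)) (at px)))"

definition D4 :: "('q::real_normed_vector ham_args \<Rightarrow> real) \<Rightarrow> 'q ham_args \<Rightarrow> 'q dual dual" where
  "D4 H = (\<lambda>(x, t, px, pt). Blinfun (frechet_derivative (\<lambda>u. H (x, t, px, u)) (at pt)))"

text \<open>
  The eight boundary values
  $(\varphi_{[a]b}, \varphi_{a[b]}, \varphi_{[a]b+1}, \varphi_{a+1[b]},
    \pi^1_{[a]b}, \pi^0_{a[b]}, \pi^1_{[a]b+1}, \pi^0_{a+1[b]})$, with their coordinate functions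
  in this order. The letter \<open>x\<close> or \<open>t\<close> is the normal direction of the edge; \<open>0\<close> and \<open>1\<close> stand for
  the edge at the lower and upper end of the element in that direction.
\<close>

type_synonym 'q bvals = "'q \<times> 'q \<times> 'q \<times> 'q \<times> 'q dual \<times> 'q dual \<times> 'q dual \<times> 'q dual"

definition phi_x0 :: "'q::real_normed_vector bvals \<Rightarrow> 'q" where
  "phi_x0 = (\<lambda>(fx0, ft0, fx1, ft1, px0, pt0, px1, pt1). fx0)"

definition phi_t0 :: "'q::real_normed_vector bvals \<Rightarrow> 'q" where
  "phi_t0 = (\<lambda>(fx0, ft0, fx1, ft1, px0, pt0, px1, pt1). ft0)"

definition phi_x1 :: "'q::real_normed_vector bvals \<Rightarrow> 'q" where
  "phi_x1 = (\<lambda>(fx0, ft0, fx1, ft1, px0, pt0, px1, pt1). fx1)"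

definition phi_t1 :: "'q::real_normed_vector bvals \<Rightarrow> 'q" where
  "phi_t1 = (\<lambda>(fx0, ft0, fx1, ft1, px0, pt0, px1, pt1). ft1)"

definition pi_x0 :: "'q::real_normed_vector bvals \<Rightarrow> 'q dual" where
  "pi_x0 = (\<lambda>(fx0, ft0, fx1, ft1, px0, pt0, px1, pt1). px0)"

definition pi_t0 :: "'q::real_normed_vector bvals \<Rightarrow> 'q dual" where
  "pi_t0 = (\<lambda>(fx0, ft0, fx1, ft1, px0, pt0, px1, pt1). pt0)"

definition pi_x1 :: "'q::real_normed_vector bvals \<Rightarrow> 'q dual" where
  "pi_x1 = (\<lambda>(fx0, ft0, fx1, ft1, px0, pt0, px1, pt1). px1)"

definition pi_t1 :: "'q::real_normed_vector bvals \<Rightarrow> 'q dual" where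
  "pi_t1 = (\<lambda>(fx0, ft0, fx1, ft1, px0, pt0, px1, pt1). pt1)"

definition H_args :: "'q::real_normed_vector bvals \<Rightarrow> 'q ham_args" where
  "H_args z = (phi_x0 z, phi_t0 z, pi_x1 z, pi_t1 z)"

definition forward_hamilton ::
    "real \<Rightarrow> real \<Rightarrow> ('q::real_normed_vector ham_args \<Rightarrow> real) \<Rightarrow> 'q bvals \<Rightarrow> bool" where
  "forward_hamilton \<Delta>t \<Delta>x H z \<longleftrightarrow>
     pi_x0 z = (1 / \<Delta>t) *\<^sub>R D1 H (H_args z) \<and>
     pi_t0 z = (1 / \<Delta>x) *\<^sub>R D2 H (H_args z) \<and>
     bidual (phi_x1 z) = (1 / \<Delta>t) *\<^sub>R D3 H (H_args z) \<and>
     bidual (phi_t1 z) = (1 / \<Delta>x) *\<^sub>R D4 H (H_args z)"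

definition first_variation ::
    "real \<Rightarrow> real \<Rightarrow> ('q::real_normed_vector ham_args \<Rightarrow> real) \<Rightarrow> 'q bvals \<Rightarrow> 'q bvals \<Rightarrow> bool" where
  "first_variation \<Delta>t \<Delta>x H z V \<longleftrightarrow>
     ext_deriv pi_x0 z V = (1 / \<Delta>t) *\<^sub>R ext_deriv (\<lambda>y. D1 H (H_args y)) z V \<and>
     ext_deriv pi_t0 z V = (1 / \<Delta>x) *\<^sub>R ext_deriv (\<lambda>y. D2 H (H_args y)) z V \<and>
     bidual (ext_deriv phi_x1 z V) = (1 / \<Delta>t) *\<^sub>R ext_deriv (\<lambda>y. D3 H (H_args y)) z V \<and>
     bidual (ext_deriv phi_t1 z V) = (1 / \<Delta>x) *\<^sub>R ext_deriv (\<lambda>y. D4 H (H_args y)) z V"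

end

theory Submission
  imports Defs
begin

text \<open>
  Write \<open>S\<close> for the Hessian of $H_d^+$ and \<open>v\<close>, \<open>w\<close> for the components of \<open>V\<close>, \<open>W\<close> along the
  arguments of $H_d^+$. The variation equations turn each pairing in the wedge products into a value
  of \<open>S\<close> with one slot restricted to a single argument; summed over the four arguments, the left-hand
  side is $S(w, v) - S(v, w)$, which vanishes because \<open>S\<close> is symmetric.

  Finite dimension enters only through the differentiability of $D_i H_d^+$ in the operator norm:
  smoothness in the sense of fixed directions gives it pointwise, and the coordinate functionals of a
  basis, which are bounded, reduce it to finitely many directions.
\<close>

section \<open>Bounded coordinates on finite-dimensional normed spaces\<close>

text \<open>Applied to differences, the bound makes the coefficients of a convergent sequence
  Cauchy. Their limits, which exist by completeness of the reals, are coefficients of the limit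
  vector.\<close>

lemma closed_span_if_coefficients_bounded:
  fixes B :: "'a::real_normed_vector set"
  assumes "finite B"
    and bound: "\<And>c b. b \<in> B \<Longrightarrow> \<bar>c b\<bar> \<le> C * norm (\<Sum>i\<in>B. c i *\<^sub>R i)"
  shows "closed (span B)"
  unfolding closed_sequential_limits
proof (intro allI impI, elim conjE)
  fix X :: "nat \<Rightarrow> 'a" and l
  assume "\<forall>n. X n \<in> span B" and lim: "X \<longlonglongrightarrow> l"
  then have "\<forall>n. \<exists>c. X n = (\<Sum>i\<in>B. c i *\<^sub>R i)"
    by (auto simp: span_finite[OF \<open>finite B\<close>])
  then obtain c where c: "\<And>n. X n = (\<Sum>i\<in>B. c n i *\<^sub>R i)"
    by metis
  have "Cauchy (\<lambda>n. c n b)" if "b \<in> B" for b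
  proof (rule metric_CauchyI)
    fix e :: real
    assume "e > 0"
    have dist_c: "dist (c m b) (c n b) \<le> \<bar>C\<bar> * dist (X m) (X n)" for m n
    proof -
      have "dist (c m b) (c n b) \<le> C * norm (\<Sum>i\<in>B. (c m i - c n i) *\<^sub>R i)"
        using bound[OF that, of "\<lambda>i. c m i - c n i"] by (simp add: dist_real_def)
      also have "\<dots> = C * dist (X m) (X n)"
        by (simp add: c dist_norm scaleR_diff_left sum_subtractf)
      also have "\<dots> \<le> \<bar>C\<bar> * dist (X m) (X n)"
        by (intro mult_right_mono) auto
      finally show ?thesis .
    qed
    have "Cauchy X"
      using lim by (rule LIMSEQ_imp_Cauchy)
    \<comment> \<open>No sign is assumed for \<open>C\<close>; adding 1 to its absolute value makes
      the denominator positive in any case.\<close>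
    moreover have "e / (\<bar>C\<bar> + 1) > 0"
      using \<open>e > 0\<close> by auto
    ultimately obtain M where M: "\<And>m n. m \<ge> M \<Longrightarrow> n \<ge> M \<Longrightarrow> dist (X m) (X n) < e / (\<bar>C\<bar> + 1)"
      by (metis metric_CauchyD)
    have "dist (c m b) (c n b) < e" if "m \<ge> M" "n \<ge> M" for m n
    proof -
      have "\<bar>C\<bar> * dist (X m) (X n) \<le> (\<bar>C\<bar> + 1) * dist (X m) (X n)"
        by (intro mult_right_mono) auto
      also have "\<dots> < e"
        using M[OF that] by (simp add: field_simps)
      finally show ?thesis
        using dist_c[of m n] by linarith
    qed
    then show "\<exists>M. \<forall>m\<ge>M. \<forall>n\<ge>M. dist (c m b) (c n b) < e"
      by blast
  qed
  then have "\<forall>b\<in>B. \<exists>k. (\<lambda>n. c n b) \<longlonglongrightarrow> k"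
    by (meson Cauchy_convergent convergent_def)
  then obtain k where "\<And>b. b \<in> B \<Longrightarrow> (\<lambda>n. c n b) \<longlonglongrightarrow> k b"
    by metis
  then have "X \<longlonglongrightarrow> (\<Sum>i\<in>B. k i *\<^sub>R i)"
    unfolding c by (intro tendsto_intros) auto
  then have "l = (\<Sum>i\<in>B. k i *\<^sub>R i)"
    using lim LIMSEQ_unique by blast
  then show "l \<in> span B"
    by (auto intro: span_sum span_scale span_base)
qed

text \<open>Induction on the basis: the new vector \<open>a\<close> lies outside
  \<open>span B\<close>, which is closed by the induction hypothesis, so \<open>a\<close> has a
  positive distance from it. This distance controls the coefficient of \<open>a\<close>, and the
  triangle inequality then controls the remaining part of the sum.\<close>

lemma independent_coefficients_bounded:
  fixes B :: "'a::real_normed_vector set"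
  assumes "finite B" and "independent B"
  shows "\<exists>C. \<forall>c. \<forall>b\<in>B. \<bar>c b\<bar> \<le> C * norm (\<Sum>i\<in>B. c i *\<^sub>R i)"
  using assms
proof (induction B)
  case empty
  show ?case by simp
next
  case (insert a B)
  have "independent B" and a: "a \<notin> span B"
    using insert.prems insert.hyps by (auto simp: independent_insert)
  then obtain C where C: "\<And>c b. b \<in> B \<Longrightarrow> \<bar>c b\<bar> \<le> C * norm (\<Sum>i\<in>B. c i *\<^sub>R i)"
    using insert.IH by blast
  have "closed (span B)"
    using insert.hyps(1) C by (rule closed_span_if_coefficients_bounded)
  then have "open (- span B)"
    by (simp add: open_closed)
  then obtain d where "d > 0" and d: "ball a d \<subseteq> - span B"
    using a by (meson ComplI openE)
  have dist_a: "d \<le> norm (a - y)" if "y \<in> span B" for y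
    using d that by (force simp: subset_iff dist_norm)
  \<comment> \<open>The first entry bounds the coefficient of \<open>a\<close>; the second bounds
    those in \<open>B\<close>, through the estimate \<open>norm_x\<close> below.\<close>
  define K where "K = max (1 / d) (\<bar>C\<bar> * (1 + norm a / d))"
  have "\<bar>c b\<bar> \<le> K * norm (\<Sum>i\<in>insert a B. c i *\<^sub>R i)" if b: "b \<in> insert a B" for c b
  proof -
    define x where "x = (\<Sum>i\<in>B. c i *\<^sub>R i)"
    have sum: "(\<Sum>i\<in>insert a B. c i *\<^sub>R i) = c a *\<^sub>R a + x"
      using insert.hyps by (simp add: x_def)
    have "x \<in> span B"
      unfolding x_def by (auto intro: span_sum span_scale span_base)
    have ca: "\<bar>c a\<bar> \<le> 1 / d * norm (c a *\<^sub>R a + x)"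
    proof (cases "c a = 0")
      case True
      then show ?thesis using \<open>d > 0\<close> by simp
    next
      case False
      \<comment> \<open>This element of \<open>span B\<close> is chosen so that multiplying the
        difference by \<open>c a\<close> gives back the whole sum.\<close>
      have "d \<le> norm (a - (- (1 / c a)) *\<^sub>R x)"
        using \<open>x \<in> span B\<close> by (intro dist_a span_scale)
      then have "\<bar>c a\<bar> * d \<le> \<bar>c a\<bar> * norm (a - (- (1 / c a)) *\<^sub>R x)"
        by (intro mult_left_mono) auto
      also have "\<dots> = norm (c a *\<^sub>R (a - (- (1 / c a)) *\<^sub>R x))"
        by simp
      also have "c a *\<^sub>R (a - (- (1 / c a)) *\<^sub>R x) = c a *\<^sub>R a + x"
        using False by (simp add: algebra_simps)
      finally show ?thesis
        using \<open>d > 0\<close> by (simp add: field_simps)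
    qed
    show ?thesis
    proof (cases "b = a")
      case True
      have "1 / d * norm (c a *\<^sub>R a + x) \<le> K * norm (c a *\<^sub>R a + x)"
        by (intro mult_right_mono) (auto simp: K_def)
      then show ?thesis
        unfolding True sum using ca by linarith
    next
      case False
      have "norm x \<le> norm (c a *\<^sub>R a + x) + norm (c a *\<^sub>R a)"
        using norm_triangle_ineq4[of "c a *\<^sub>R a + x" "c a *\<^sub>R a"] by simp
      also have "norm (c a *\<^sub>R a) \<le> 1 / d * norm (c a *\<^sub>R a + x) * norm a"
        unfolding norm_scaleR by (intro mult_right_mono ca) simp
      finally have norm_x: "norm x \<le> (1 + norm a / d) * norm (c a *\<^sub>R a + x)"
        by (simp add: algebra_simps)
      have "\<bar>c b\<bar> \<le> C * norm x"
        unfolding x_def using C b False by auto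
      also have "\<dots> \<le> \<bar>C\<bar> * norm x"
        by (intro mult_right_mono) auto
      also have "\<dots> \<le> \<bar>C\<bar> * ((1 + norm a / d) * norm (c a *\<^sub>R a + x))"
        by (intro mult_left_mono norm_x) auto
      also have "\<dots> = \<bar>C\<bar> * (1 + norm a / d) * norm (c a *\<^sub>R a + x)"
        by simp
      also have "\<dots> \<le> K * norm (c a *\<^sub>R a + x)"
        by (intro mult_right_mono) (auto simp: K_def)
      finally show ?thesis
        unfolding sum .
    qed
  qed
  then show ?case by blast
qed

text \<open>A maximal independent subset of \<open>S\<close> is a basis, and the coefficient bound
  makes its coordinate functionals continuous.\<close>

lemma finite_span_coordinates:
  fixes S :: "'a::real_normed_vector set"
  assumes "finite S" and "span S = UNIV"
  obtains B and \<xi> :: "'a \<Rightarrow> 'a \<Rightarrow>\<^sub>L real"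
  where "finite B" and "\<And>x. x = (\<Sum>b\<in>B. blinfun_apply (\<xi> b) x *\<^sub>R b)"
proof -
  obtain B where B: "B \<subseteq> S" "independent B" "S \<subseteq> span B"
    by (rule maximal_independent_subset)
  have "finite B"
    using B(1) assms(1) finite_subset by blast
  have span: "span B = UNIV"
    using B(3) assms(2) span_minimal[of S "span B"] by auto
  have expand: "(\<Sum>b\<in>B. representation B x b *\<^sub>R b) = x" for x
    by (rule sum_representation_eq) (use B(2) span \<open>finite B\<close> in auto)
  obtain C where C: "\<And>c b. b \<in> B \<Longrightarrow> \<bar>c b\<bar> \<le> C * norm (\<Sum>i\<in>B. c i *\<^sub>R i)"
    using independent_coefficients_bounded[OF \<open>finite B\<close> B(2)] by blast
  have bl: "bounded_linear (\<lambda>x. representation B x b)" if "b \<in> B" for b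
  proof (rule bounded_linear_intro)
    show "norm (representation B x b) \<le> norm x * C" for x
      using C[OF that, of "representation B x"] by (simp add: expand mult.commute)
  qed (use B(2) span in \<open>auto simp: representation_add representation_scale\<close>)
  show thesis
  proof
    show "finite B" by fact
    \<comment> \<open>\<open>sum.cong\<close> provides \<open>b \<in> B\<close>, the condition under
      which \<open>bl\<close> lets \<open>Blinfun\<close> be evaluated.\<close>
    show "x = (\<Sum>b\<in>B. blinfun_apply (Blinfun (\<lambda>x. representation B x b)) x *\<^sub>R b)" for x
      using expand[of x] by (simp add: bl bounded_linear_Blinfun_apply cong: sum.cong)
  qed
qed

lemma blinfun_sum_coordinates:
  fixes p :: "'a::real_normed_vector \<Rightarrow>\<^sub>L 'b::real_normed_vector" and \<xi> :: "'a \<Rightarrow> 'a \<Rightarrow>\<^sub>L real"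
  assumes "\<And>x. x = (\<Sum>b\<in>B. blinfun_apply (\<xi> b) x *\<^sub>R b)"
  shows "blinfun_apply p x = (\<Sum>b\<in>B. blinfun_apply (\<xi> b) x *\<^sub>R blinfun_apply p b)"
  by (subst assms[of x]) (simp add: blinfun.sum_right blinfun.scaleR_right)

lemma functional_sum_coordinates:
  fixes p :: "'a::real_normed_vector \<Rightarrow>\<^sub>L real" and \<xi> :: "'a \<Rightarrow> 'a \<Rightarrow>\<^sub>L real"
  assumes "\<And>x. x = (\<Sum>b\<in>B. blinfun_apply (\<xi> b) x *\<^sub>R b)"
  shows "p = (\<Sum>b\<in>B. blinfun_apply p b *\<^sub>R \<xi> b)"
proof (rule blinfun_eqI)
  show "blinfun_apply p x = blinfun_apply (\<Sum>b\<in>B. blinfun_apply p b *\<^sub>R \<xi> b) x" for x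
    by (subst blinfun_sum_coordinates[OF assms, of p x])
      (simp add: blinfun.sum_left blinfun.scaleR_left mult.commute)
qed

text \<open>The coordinate functionals span the dual. This is needed for \<open>D3\<close> and
  \<open>D4\<close>, whose values are functionals on the dual.\<close>

lemma finite_span_dual:
  assumes "\<exists>S::'a::real_normed_vector set. finite S \<and> span S = UNIV"
  shows "\<exists>S::('a::real_normed_vector \<Rightarrow>\<^sub>L real) set. finite S \<and> span S = UNIV"
proof -
  obtain B and \<xi> :: "'a \<Rightarrow> 'a \<Rightarrow>\<^sub>L real" where "finite B"
    and \<xi>: "\<And>x. x = (\<Sum>b\<in>B. blinfun_apply (\<xi> b) x *\<^sub>R b)"
    using assms finite_span_coordinates by metis
  have "p \<in> span (\<xi> ` B)" for p
    by (subst functional_sum_coordinates[OF \<xi>, of p]) (intro span_sum span_scale span_base imageI)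
  with \<open>finite B\<close> show ?thesis
    by (intro exI[of _ "\<xi> ` B"]) auto
qed

text \<open>Expanded in coordinate functionals, \<open>f\<close> is a finite sum of differentiable
  scalar functions times constant vectors, so pointwise differentiability becomes differentiability
  in the operator norm.\<close>

lemma differentiable_functional:
  fixes f :: "'e::real_normed_vector \<Rightarrow> 'a::real_normed_vector \<Rightarrow>\<^sub>L real"
  assumes "\<exists>S::'a set. finite S \<and> span S = UNIV"
    and "\<And>u. (\<lambda>y. blinfun_apply (f y) u) differentiable (at z)"
  shows "f differentiable (at z)"
proof -
  obtain B and \<xi> :: "'a \<Rightarrow> 'a \<Rightarrow>\<^sub>L real" where "finite B"
    and \<xi>: "\<And>x. x = (\<Sum>b\<in>B. blinfun_apply (\<xi> b) x *\<^sub>R b)"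
    using assms(1) finite_span_coordinates by metis
  have "(\<lambda>y. \<Sum>b\<in>B. blinfun_apply (f y) b *\<^sub>R \<xi> b) differentiable (at z)"
    using \<open>finite B\<close> assms(2) by (intro differentiable_sum differentiable_scaleR ballI) auto
  then show ?thesis
    by (simp flip: functional_sum_coordinates[OF \<xi>])
qed

section \<open>Symmetry of the second derivative\<close>

text \<open>The order of differentiation, first along \<open>v\<close> and then along the last
  argument, is that of \<open>C_k\<close>, so that the facts about smoothness unfold directly to
  this form.\<close>

definition second_derivative ::
    "('a::real_normed_vector \<Rightarrow> 'b::real_normed_vector) \<Rightarrow> 'a \<Rightarrow> 'a \<Rightarrow> 'a \<Rightarrow> 'b" where
  "second_derivative f x v = frechet_derivative (\<lambda>y. frechet_derivative f (at y) v) (at x)"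

lemma line_derivative:
  fixes f :: "'a::real_normed_vector \<Rightarrow> real"
  assumes "f differentiable (at (x + s *\<^sub>R v))"
  shows "((\<lambda>s. f (x + s *\<^sub>R v)) has_real_derivative frechet_derivative f (at (x + s *\<^sub>R v)) v) (at s)"
proof -
  let ?D = "frechet_derivative f (at (x + s *\<^sub>R v))"
  have D: "(f has_derivative ?D) (at (x + s *\<^sub>R v))"
    using assms frechet_derivative_works by blast
  have "((\<lambda>s. f (x + s *\<^sub>R v)) has_derivative (\<lambda>h. ?D (h *\<^sub>R v))) (at s)"
    by (rule has_derivative_compose[where f = "\<lambda>s. x + s *\<^sub>R v" and g = f, OF _ D])
      (auto intro!: derivative_eq_intros)
  moreover have "?D (h *\<^sub>R v) = h * ?D v" for h
    using linear_scale[OF has_derivative_linear[OF D], of h v] by simp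
  ultimately show ?thesis
    by (simp add: has_field_derivative_def mult_commute_abs)
qed

text \<open>The mean value theorem is used twice: along \<open>v\<close> for the difference
  \<open>g\<close> of two parallel lines, then along \<open>w\<close> for the directional derivative
  \<open>k\<close>. The second difference on the left is symmetric in \<open>v\<close> and
  \<open>w\<close>.\<close>

lemma second_difference_mean_value:
  fixes f :: "'a::real_normed_vector \<Rightarrow> real"
  assumes "\<And>x. f differentiable (at x)"
    and "\<And>x. (\<lambda>y. frechet_derivative f (at y) v) differentiable (at x)"
    and "h > 0"
  obtains s t where "0 < s" "s < h" "0 < t" "t < h"
    and "f (x + h *\<^sub>R v + h *\<^sub>R w) - f (x + h *\<^sub>R v) - f (x + h *\<^sub>R w) + f x =
      h * h * second_derivative f (x + s *\<^sub>R v + t *\<^sub>R w) v w"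
proof -
  define g where "g s = f (x + h *\<^sub>R w + s *\<^sub>R v) - f (x + s *\<^sub>R v)" for s
  have g': "(g has_real_derivative
      frechet_derivative f (at (x + h *\<^sub>R w + s *\<^sub>R v)) v - frechet_derivative f (at (x + s *\<^sub>R v)) v) (at s)" for s
    unfolding g_def by (intro DERIV_diff line_derivative assms)
  obtain s where s: "0 < s" "s < h" "g h - g 0 = (h - 0) *
      (frechet_derivative f (at (x + h *\<^sub>R w + s *\<^sub>R v)) v - frechet_derivative f (at (x + s *\<^sub>R v)) v)"
    using MVT2[OF \<open>h > 0\<close> g'] by blast
  define k where "k t = frechet_derivative f (at (x + s *\<^sub>R v + t *\<^sub>R w)) v" for t
  have k': "(k has_real_derivative second_derivative f (x + s *\<^sub>R v + t *\<^sub>R w) v w) (at t)" for t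
    unfolding k_def second_derivative_def by (rule line_derivative) (rule assms)
  obtain t where t: "0 < t" "t < h"
      "k h - k 0 = (h - 0) * second_derivative f (x + s *\<^sub>R v + t *\<^sub>R w) v w"
    using MVT2[OF \<open>h > 0\<close> k'] by blast
  have "g h - g 0 = h * (k h - k 0)"
    using s(3) by (simp add: k_def add_ac)
  with s t that show thesis
    by (auto simp: g_def add_ac algebra_simps)
qed

text \<open>Schwarz's theorem. Both mixed derivatives represent the same symmetric second
  difference, at points that converge to \<open>x\<close> as the increment shrinks; continuity
  carries the equality to \<open>x\<close>.\<close>

lemma second_derivative_commute:
  fixes f :: "'a::real_normed_vector \<Rightarrow> real"
  assumes "\<And>x. f differentiable (at x)"
    and "\<And>v x. (\<lambda>y. frechet_derivative f (at y) v) differentiable (at x)"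
    and cont: "\<And>v w. continuous_on UNIV (\<lambda>y. second_derivative f y v w)"
  shows "second_derivative f x v w = second_derivative f x w v"
proof -
  define \<epsilon> where "\<epsilon> n = 1 / real (Suc n)" for n
  have \<epsilon>: "\<epsilon> n > 0" for n
    by (simp add: \<epsilon>_def)
  have lim_\<epsilon>: "\<epsilon> \<longlonglongrightarrow> 0"
    unfolding \<epsilon>_def using LIMSEQ_inverse_real_of_nat by (simp add: inverse_eq_divide)
  have "\<forall>n. \<exists>s t s' t'. 0 < s \<and> s < \<epsilon> n \<and> 0 < t \<and> t < \<epsilon> n \<and> 0 < s' \<and> s' < \<epsilon> n \<and> 0 < t' \<and> t' < \<epsilon> n \<and>
      second_derivative f (x + s *\<^sub>R v + t *\<^sub>R w) v w =
      second_derivative f (x + s' *\<^sub>R w + t' *\<^sub>R v) w v"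
  proof
    fix n
    obtain s t where st: "0 < s" "s < \<epsilon> n" "0 < t" "t < \<epsilon> n"
      and 1: "f (x + \<epsilon> n *\<^sub>R v + \<epsilon> n *\<^sub>R w) - f (x + \<epsilon> n *\<^sub>R v) - f (x + \<epsilon> n *\<^sub>R w) + f x =
        \<epsilon> n * \<epsilon> n * second_derivative f (x + s *\<^sub>R v + t *\<^sub>R w) v w"
      using second_difference_mean_value[OF assms(1,2) \<epsilon>] .
    obtain s' t' where st': "0 < s'" "s' < \<epsilon> n" "0 < t'" "t' < \<epsilon> n"
      and 2: "f (x + \<epsilon> n *\<^sub>R w + \<epsilon> n *\<^sub>R v) - f (x + \<epsilon> n *\<^sub>R w) - f (x + \<epsilon> n *\<^sub>R v) + f x =
        \<epsilon> n * \<epsilon> n * second_derivative f (x + s' *\<^sub>R w + t' *\<^sub>R v) w v"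
      using second_difference_mean_value[OF assms(1,2) \<epsilon>] .
    have "\<epsilon> n * \<epsilon> n * second_derivative f (x + s *\<^sub>R v + t *\<^sub>R w) v w =
        \<epsilon> n * \<epsilon> n * second_derivative f (x + s' *\<^sub>R w + t' *\<^sub>R v) w v"
      unfolding 1[symmetric] 2[symmetric] by (simp add: add_ac)
    then have "second_derivative f (x + s *\<^sub>R v + t *\<^sub>R w) v w =
        second_derivative f (x + s' *\<^sub>R w + t' *\<^sub>R v) w v"
      using \<epsilon>[of n] by simp
    with st st' show "\<exists>s t s' t'. 0 < s \<and> s < \<epsilon> n \<and> 0 < t \<and> t < \<epsilon> n \<and> 0 < s' \<and> s' < \<epsilon> n \<and> 0 < t' \<and> t' < \<epsilon> n \<and>
        second_derivative f (x + s *\<^sub>R v + t *\<^sub>R w) v w =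
        second_derivative f (x + s' *\<^sub>R w + t' *\<^sub>R v) w v"
      by blast
  qed
  then obtain s t s' t' where pos: "\<And>n. 0 < s n \<and> 0 < t n \<and> 0 < s' n \<and> 0 < t' n"
    and less: "\<And>n. s n < \<epsilon> n \<and> t n < \<epsilon> n \<and> s' n < \<epsilon> n \<and> t' n < \<epsilon> n"
    and eq: "\<And>n. second_derivative f (x + s n *\<^sub>R v + t n *\<^sub>R w) v w =
      second_derivative f (x + s' n *\<^sub>R w + t' n *\<^sub>R v) w v"
    by metis
  have null: "r \<longlonglongrightarrow> 0" if "\<And>n. 0 < r n \<and> r n < \<epsilon> n" for r
    by (rule tendsto_sandwich[OF _ _ tendsto_const lim_\<epsilon>]) (use that in \<open>auto intro!: always_eventually less_imp_le\<close>)
  have lim: "(\<lambda>n. second_derivative f (x + r n *\<^sub>R a + r' n *\<^sub>R b) a b) \<longlonglongrightarrow> second_derivative f x a b"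
    if "\<And>n. 0 < r n \<and> r n < \<epsilon> n" and "\<And>n. 0 < r' n \<and> r' n < \<epsilon> n" for r r' a b
  proof -
    have "(\<lambda>n. x + r n *\<^sub>R a + r' n *\<^sub>R b) \<longlonglongrightarrow> x + 0 *\<^sub>R a + 0 *\<^sub>R b"
      by (intro tendsto_intros null that)
    moreover have "isCont (\<lambda>y. second_derivative f y a b) x"
      using cont by (simp add: continuous_on_eq_continuous_at)
    ultimately show ?thesis
      by (intro isCont_tendsto_compose[where g = "\<lambda>y. second_derivative f y a b"]) simp_all
  qed
  have "(\<lambda>n. second_derivative f (x + s n *\<^sub>R v + t n *\<^sub>R w) v w) \<longlonglongrightarrow> second_derivative f x v w"
    using pos less by (intro lim) auto
  \<comment> \<open>By \<open>eq\<close> this is also the sequence with \<open>v\<close> and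
    \<open>w\<close> exchanged, so it has both values as limits.\<close>
  moreover have "(\<lambda>n. second_derivative f (x + s n *\<^sub>R v + t n *\<^sub>R w) v w) \<longlonglongrightarrow> second_derivative f x w v"
    unfolding eq using pos less by (intro lim) auto
  ultimately show ?thesis
    by (rule LIMSEQ_unique)
qed

lemma second_derivative_add_left:
  assumes "\<And>x. f differentiable (at x)"
    and "\<And>v x. (\<lambda>y. frechet_derivative f (at y) v) differentiable (at x)"
  shows "second_derivative f x (u + v) w = second_derivative f x u w + second_derivative f x v w"
proof -
  have "frechet_derivative f (at y) (u + v) = frechet_derivative f (at y) u + frechet_derivative f (at y) v" for y
    using linear_frechet_derivative[OF assms(1)] by (rule linear_add)
  then have "second_derivative f x (u + v) =
      frechet_derivative (\<lambda>y. frechet_derivative f (at y) u + frechet_derivative f (at y) v) (at x)"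
    by (simp add: second_derivative_def)
  also have "\<dots> = (\<lambda>w. second_derivative f x u w + second_derivative f x v w)"
    unfolding second_derivative_def
    by (rule sym, rule frechet_derivative_at, intro has_derivative_add)
      (use assms(2) frechet_derivative_works in blast)+
  finally show ?thesis by simp
qed

section \<open>Derivatives of the partial derivatives and of the boundary values\<close>

text \<open>Here \<open>G\<close> stands for some \<open>D_i H\<close>, \<open>L\<close> for the
  insertion of a direction into the i-th slot, and \<open>K\<close> for \<open>H_args\<close>. The
  chain rule gives the formula after evaluation at \<open>u\<close>; evaluation is bounded linear
  and so commutes with the derivative of \<open>G\<close>, once that exists in the operator
  norm.\<close>

lemma second_derivative_functional:
  fixes f :: "'e::real_normed_vector \<Rightarrow> real"
    and G :: "'e \<Rightarrow> 'a::real_normed_vector \<Rightarrow>\<^sub>L real" and K :: "'z::real_normed_vector \<Rightarrow> 'e"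
  assumes fin: "\<exists>S::'a set. finite S \<and> span S = UNIV"
    and diff: "\<And>v x. (\<lambda>y. frechet_derivative f (at y) v) differentiable (at x)"
    and G: "\<And>q u. blinfun_apply (G q) u = frechet_derivative f (at q) (L u)"
    and K: "bounded_linear K"
  shows "blinfun_apply (ext_deriv (\<lambda>y. G (K y)) z V) u = second_derivative f (K z) (L u) (K V)"
proof -
  have comp: "((\<lambda>y. blinfun_apply (G (K y)) u) has_derivative
      (\<lambda>V. second_derivative f (K z) (L u) (K V))) (at z)" for u
    unfolding G second_derivative_def
    by (rule has_derivative_compose[of K K]) (use K diff frechet_derivative_works in
      \<open>auto intro: bounded_linear_imp_has_derivative\<close>)
  then have "(\<lambda>y. G (K y)) differentiable (at z)"
    by (intro differentiable_functional[OF fin]) (auto simp: differentiable_def)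
  then have "((\<lambda>y. G (K y)) has_derivative ext_deriv (\<lambda>y. G (K y)) z) (at z)"
    unfolding ext_deriv_def using frechet_derivative_works by blast
  then have "((\<lambda>y. blinfun_apply (G (K y)) u) has_derivative
      (\<lambda>V. blinfun_apply (ext_deriv (\<lambda>y. G (K y)) z V) u)) (at z)"
    by (rule bounded_linear.has_derivative[OF blinfun.bounded_linear_left])
  from has_derivative_unique[OF this comp] show ?thesis
    by meson
qed

text \<open>Chain rule for the map \<open>g\<close> that varies one argument and freezes the others.
  The derivative is bounded linear, so \<open>Blinfun\<close> represents it faithfully.\<close>

lemma partial_derivative:
  fixes H :: "'e::real_normed_vector \<Rightarrow> real" and L :: "'a::real_normed_vector \<Rightarrow> 'e"
  assumes "H differentiable (at (g x))" and "(g has_derivative L) (at x)"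
  shows "blinfun_apply (Blinfun (frechet_derivative (\<lambda>u. H (g u)) (at x))) u =
    frechet_derivative H (at (g x)) (L u)"
proof -
  have d: "((\<lambda>u. H (g u)) has_derivative (\<lambda>u. frechet_derivative H (at (g x)) (L u))) (at x)"
    by (rule has_derivative_compose[OF assms(2)]) (use assms(1) frechet_derivative_works in blast)
  have "frechet_derivative (\<lambda>u. H (g u)) (at x) = (\<lambda>u. frechet_derivative H (at (g x)) (L u))"
    using frechet_derivative_at[OF d] by simp
  then show ?thesis
    using has_derivative_bounded_linear[OF d] by (simp add: bounded_linear_Blinfun_apply)
qed

lemma
  fixes H :: "'q::real_normed_vector ham_args \<Rightarrow> real"
  assumes "\<And>q. H differentiable (at q)"
  shows D1_apply: "blinfun_apply (D1 H q) u = frechet_derivative H (at q) (u, 0, 0, 0)"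
    and D2_apply: "blinfun_apply (D2 H q) u = frechet_derivative H (at q) (0, u, 0, 0)"
    and D3_apply: "blinfun_apply (D3 H q) p = frechet_derivative H (at q) (0, 0, p, 0)"
    and D4_apply: "blinfun_apply (D4 H q) p = frechet_derivative H (at q) (0, 0, 0, p)"
proof -
  obtain x t px pt where q: "q = (x, t, px, pt)"
    by (cases q)
  show "blinfun_apply (D1 H q) u = frechet_derivative H (at q) (u, 0, 0, 0)"
    unfolding D1_def q prod.case
    by (rule partial_derivative[OF assms]) (auto intro!: derivative_eq_intros simp: zero_prod_def)
  show "blinfun_apply (D2 H q) u = frechet_derivative H (at q) (0, u, 0, 0)"
    unfolding D2_def q prod.case
    by (rule partial_derivative[OF assms]) (auto intro!: derivative_eq_intros simp: zero_prod_def)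
  show "blinfun_apply (D3 H q) p = frechet_derivative H (at q) (0, 0, p, 0)"
    unfolding D3_def q prod.case
    by (rule partial_derivative[OF assms]) (auto intro!: derivative_eq_intros simp: zero_prod_def)
  show "blinfun_apply (D4 H q) p = frechet_derivative H (at q) (0, 0, 0, p)"
    unfolding D4_def q prod.case
    by (rule partial_derivative[OF assms]) (auto intro!: derivative_eq_intros simp: zero_prod_def)
qed

lemma bidual_apply: "blinfun_apply (bidual x) p = blinfun_apply p x"
  unfolding bidual_def by (simp add: bounded_linear_Blinfun_apply blinfun.bounded_linear_left)

lemma bounded_linear_boundary_values:
  shows "bounded_linear phi_x0" "bounded_linear phi_t0" "bounded_linear phi_x1" "bounded_linear phi_t1"
    "bounded_linear pi_x0" "bounded_linear pi_t0" "bounded_linear pi_x1" "bounded_linear pi_t1"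
  unfolding phi_x0_def phi_t0_def phi_x1_def phi_t1_def pi_x0_def pi_t0_def pi_x1_def pi_t1_def
    case_prod_beta'
  by (intro bounded_linear_fst_comp bounded_linear_snd_comp bounded_linear_ident)+

lemma bounded_linear_H_args: "bounded_linear H_args"
  unfolding H_args_def by (intro bounded_linear_Pair bounded_linear_boundary_values)

text \<open>Hence the exterior derivative of a boundary value just reads off a component of the
  tangent vector.\<close>

lemma ext_deriv_bounded_linear: "bounded_linear f \<Longrightarrow> ext_deriv f z = f"
  unfolding ext_deriv_def
  by (metis bounded_linear_imp_has_derivative frechet_derivative_at)

theorem proposition2p2:
  fixes H :: "'q::real_normed_vector ham_args \<Rightarrow> real"
    and \<Delta>t \<Delta>x :: real
    and z V W :: "'q bvals"
  assumes "\<exists>B::'q set. finite B \<and> span B = UNIV"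
    and "\<Delta>t > 0" and "\<Delta>x > 0"
    and "smooth H"
    and "forward_hamilton \<Delta>t \<Delta>x H z"
    and "first_variation \<Delta>t \<Delta>x H z V"
    and "first_variation \<Delta>t \<Delta>x H z W"
  shows "\<Delta>t * wedge (ext_deriv phi_x1 z) (ext_deriv pi_x1 z) V W
       - \<Delta>t * wedge (ext_deriv phi_x0 z) (ext_deriv pi_x0 z) V W
       + \<Delta>x * wedge (ext_deriv phi_t1 z) (ext_deriv pi_t1 z) V W
       - \<Delta>x * wedge (ext_deriv phi_t0 z) (ext_deriv pi_t0 z) V W = 0"
proof -
  have "C_k (Suc (Suc 0)) H"
    using \<open>smooth H\<close> unfolding smooth_def by blast
  then have diff1: "H differentiable (at x)"
    and diff2: "(\<lambda>y. frechet_derivative H (at y) v) differentiable (at x)"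
    and cont: "continuous_on UNIV (\<lambda>y. second_derivative H y v w)" for x v w
    unfolding C_k.simps second_derivative_def by blast+
  note fin = assms(1) finite_span_dual[OF assms(1)]
  define S where "S = second_derivative H (H_args z)"
  note lin = bounded_linear_boundary_values[THEN ext_deriv_bounded_linear]
  \<comment> \<open>The variation equations cleared of their denominators. The test vectors
    \<open>u\<close> and \<open>p\<close> stay arbitrary because the wedge products pair components
    of \<open>V\<close> with components of \<open>W\<close>.\<close>
  have variation:
    "\<Delta>t * blinfun_apply (pi_x0 U) u = S (u, 0, 0, 0) (H_args U)"
    "\<Delta>x * blinfun_apply (pi_t0 U) u = S (0, u, 0, 0) (H_args U)"
    "\<Delta>t * blinfun_apply p (phi_x1 U) = S (0, 0, p, 0) (H_args U)"
    "\<Delta>x * blinfun_apply p (phi_t1 U) = S (0, 0, 0, p) (H_args U)"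
    if "first_variation \<Delta>t \<Delta>x H z U" for U u p
  proof -
    note U = that[unfolded first_variation_def lin]
    note second = second_derivative_functional[OF _ diff2 _ bounded_linear_H_args]
    show "\<Delta>t * blinfun_apply (pi_x0 U) u = S (u, 0, 0, 0) (H_args U)"
      using U \<open>\<Delta>t > 0\<close> second[OF fin(1) D1_apply[OF diff1]]
      by (simp add: blinfun.scaleR_left S_def)
    show "\<Delta>x * blinfun_apply (pi_t0 U) u = S (0, u, 0, 0) (H_args U)"
      using U \<open>\<Delta>x > 0\<close> second[OF fin(1) D2_apply[OF diff1]]
      by (simp add: blinfun.scaleR_left S_def)
    \<comment> \<open>Now the tested functionals live on the dual, hence \<open>fin(2)\<close>;
      \<open>bidual_apply\<close> then returns to the pairing of \<open>p\<close> with a vector of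
      Q.\<close>
    have "\<Delta>t * blinfun_apply (bidual (phi_x1 U)) p = S (0, 0, p, 0) (H_args U)"
      using U \<open>\<Delta>t > 0\<close> second[OF fin(2) D3_apply[OF diff1]]
      by (simp add: blinfun.scaleR_left S_def)
    then show "\<Delta>t * blinfun_apply p (phi_x1 U) = S (0, 0, p, 0) (H_args U)"
      by (simp add: bidual_apply)
    have "\<Delta>x * blinfun_apply (bidual (phi_t1 U)) p = S (0, 0, 0, p) (H_args U)"
      using U \<open>\<Delta>x > 0\<close> second[OF fin(2) D4_apply[OF diff1]]
      by (simp add: blinfun.scaleR_left S_def)
    then show "\<Delta>x * blinfun_apply p (phi_t1 U) = S (0, 0, 0, p) (H_args U)"
      by (simp add: bidual_apply)
  qed
  have split: "S (H_args U) w = S (phi_x0 U, 0, 0, 0) w + S (0, phi_t0 U, 0, 0) w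
      + S (0, 0, pi_x1 U, 0) w + S (0, 0, 0, pi_t1 U) w" for U w
    unfolding S_def second_derivative_add_left[OF diff1 diff2, symmetric] by (simp add: H_args_def)
  have "S (H_args V) (H_args W) = S (H_args W) (H_args V)"
    unfolding S_def by (rule second_derivative_commute[OF diff1 diff2 cont])
  then show ?thesis
    \<comment> \<open>\<open>split\<close> expands both sides of the symmetry fact into the eight
      terms that \<open>variation\<close> produces in the goal; the rest is linear in these
      terms.\<close>
    unfolding lin wedge_def right_diff_distrib
      variation[OF \<open>first_variation \<Delta>t \<Delta>x H z V\<close>] variation[OF \<open>first_variation \<Delta>t \<Delta>x H z W\<close>]
      split by linarith
qed

end
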